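(* There is a set $X\subseteq\mathbb{Q}^+$ of positive rational numbers for which $\Sigma:\mathcal{F}(X)\to\mathbb{Q}^+$ is a surjection, but for which $1\in X$ and the only $S\in\mathcal{F}(X)$ with $\Sigma S=1$ is $S=\{1\}$.
   Context: $\mathbb{Q}^+$ is the set of positive rational numbers. For $X\subseteq\mathbb{Q}^+$, $\mathcal{F}(X)$ is the family of all finite nonempty subsets of $X$. For a finite nonempty $S\subseteq\mathbb{Q}^+$, $\Sigma S:=\sum_{x\in S}x$. *)

theory Defs
  imports Complex_Main
begin

definition Qpos :: "rat set" where
  "Qpos = {q. 0 < q}"

definition fin_nonempty_subsets :: "'a set \<Rightarrow> 'a set set" where
  "fin_nonempty_subsets X = {S. S \<subseteq> X \<and> finite S \<and> S \<noteq> {}}"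

end

theory Submission
  imports Defs "HOL-Library.Countable"
begin

text \<open>
  Every rational \<open>q \<ge> 1\<close> can simply be put into \<open>X\<close>: a sum of positive numbers that uses an element
  \<open>q \<ge> 1\<close> equals \<open>1\<close> only if it is \<open>q = 1\<close> alone. So everything happens below \<open>1\<close>: one needs a set
  \<open>Y\<close> of rationals in \<open>(0,1)\<close> that represents all rationals in \<open>(0,1)\<close>, but not \<open>1\<close>.

  Representing \<open>1 - \<Sum>A\<close> for a finite \<open>A \<subseteq> Y\<close> cannot be left until late and then be done with new
  elements, since together with \<open>A\<close> they would give \<open>1\<close>. What resolves this is to let \<open>Y\<close> be an
  infinite set with total at most \<open>1\<close>: then every finite subset has sum strictly below \<open>1\<close>, and the
  task becomes to represent all rationals without exhausting the total.

  The set \<open>Y\<close> is the union of a chain of finite sets \<open>F\<close>, each of sum less than \<open>1\<close>, such that the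
  gaps between neighbouring subset sums of \<open>F\<close> stay below the room \<open>1 - \<Sum>F\<close> that is left (predicate
  \<open>gaps_below_room\<close>). Because of the gap condition, any \<open>q\<close> in \<open>(0,1)\<close> exceeds some subset sum by an
  amount \<open>d\<close> smaller than the room, and so \<open>q\<close> becomes a subset sum when new numbers of total \<open>d\<close> are
  added. If these are all tiny, their own subset sums are almost dense in \<open>[0,d]\<close>; adding them thus
  shortens each old gap by \<open>d\<close>, which is exactly the loss of room, and the condition survives
  (\<open>gaps_below_room_extend\<close>). Running through all rationals gives \<open>Y\<close>.
\<close>

section \<open>Sums of small numbers\<close>

text \<open>Add up \<open>N\<close> one element at a time: the running sum passes \<open>t\<close> in a step shorter than \<open>e\<close>.\<close>

lemma subset_sum_just_below:
  fixes N :: "'a::linordered_idom set"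
  assumes "finite N" "\<And>x. x \<in> N \<Longrightarrow> x < e" "0 \<le> t" "t < \<Sum>N"
  shows "\<exists>M\<subseteq>N. \<Sum>M \<le> t \<and> t < \<Sum>M + e"
  using assms
proof (induction N rule: finite_induct)
  case empty
  then show ?case by simp
next
  case (insert x N)
  show ?case
  proof (cases "t < \<Sum>N")
    case True
    then show ?thesis using insert by (meson insertCI subset_insertI2)
  next
    case False
    moreover have "x < e" using insert.prems by simp
    ultimately have "\<Sum>N \<le> t \<and> t < \<Sum>N + e"
      using insert by (auto simp: algebra_simps intro: less_trans)
    then show ?thesis by blast
  qed
qed

text \<open>
  The summands have to be distinct, so \<open>d\<close> is split in the ratio \<open>1 : 2 : \<dots> : k\<close> rather than into
  equal parts.
\<close>

lemma sum_of_small_distinct: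
  fixes d e :: "'a::archimedean_field"
  assumes "0 < d" "0 < e"
  obtains N where "finite N" "\<Sum>N = d" "\<And>x. x \<in> N \<Longrightarrow> 0 < x" "\<And>x. x \<in> N \<Longrightarrow> x < e"
proof -
  obtain k :: nat where k: "2 * d / e < of_nat k"
    using reals_Archimedean2 by blast
  have kpos: "(0::'a) < of_nat k"
    using k assms by (meson divide_pos_pos less_trans mult_pos_pos zero_less_numeral)
  define c :: 'a where "c = 2 * d / (of_nat k * (of_nat k + 1))"
  have c: "c > 0"
    unfolding c_def using kpos assms
    by (intro divide_pos_pos mult_pos_pos add_pos_pos) auto
  define N where "N = (\<lambda>i. of_nat i * c) ` {1..k}"
  have inj: "inj_on (\<lambda>i. of_nat i * c) {1..k}"
    using c by (auto simp: inj_on_def)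
  have "\<Sum>N = (\<Sum>i=1..k. of_nat i) * c"
    unfolding N_def sum.reindex[OF inj] by (simp add: sum_distrib_right)
  moreover have "2 * (\<Sum>i=1..k. (of_nat i :: 'a)) = of_nat k * (of_nat k + 1)"
    using double_gauss_sum_from_Suc_0[of k, where 'a='a] by simp
  ultimately have "2 * \<Sum>N = of_nat k * (of_nat k + 1) * c"
    by (metis mult.assoc)
  also have "\<dots> = 2 * d"
    unfolding c_def using kpos by (simp add: add_pos_pos less_imp_neq[symmetric])
  finally have sum: "\<Sum>N = d" by simp
  have small: "x < e" if x: "x \<in> N" for x
  proof -
    obtain i where i: "i \<le> k" "x = of_nat i * c" using x N_def by auto
    have "x \<le> of_nat k * c" using i c by simp
    also have "\<dots> = 2 * d / (of_nat k + 1)" unfolding c_def using kpos by simp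
    also have "\<dots> \<le> 2 * d / of_nat k"
      using kpos assms by (intro divide_left_mono mult_pos_pos add_pos_pos) auto
    also have "\<dots> < e"
      using k kpos assms by (simp add: pos_divide_less_eq mult.commute)
    finally show ?thesis .
  qed
  show thesis
    by (rule that[of N]) (use sum small c in \<open>auto simp: N_def\<close>)
qed

section \<open>Finite sets whose subset sums leave only small gaps\<close>

text \<open>
  For \<open>\<Sum>F \<le> q < 1\<close> the choice \<open>B = F\<close> always works, so the last conjunct is really about the gaps
  between subset sums. It is phrased through \<open>q\<close> because \<open>q - \<Sum>B\<close> is the amount still to be added
  in order to represent \<open>q\<close>.
\<close>

definition gaps_below_room :: "rat set \<Rightarrow> bool" where
  "gaps_below_room F \<longleftrightarrow> finite F \<and> F \<subseteq> Qpos \<and> \<Sum>F < 1 \<and>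
     (\<forall>q. 0 \<le> q \<and> q < 1 \<longrightarrow> (\<exists>B\<subseteq>F. \<Sum>B \<le> q \<and> q - \<Sum>B < 1 - \<Sum>F))"

lemma gaps_below_room_empty: "gaps_below_room {}"
  by (simp add: gaps_below_room_def)

text \<open>
  Why the new set \<open>F \<union> N\<close> inherits the property: let \<open>p\<close> exceed the subset sum of \<open>C \<subseteq> F\<close> by less
  than the old room. If the excess is at least \<open>d = \<Sum>N\<close>, using all of \<open>N\<close> reduces it by the same
  \<open>d\<close> by which the room shrinks; otherwise part of \<open>N\<close> reduces it below a bound for the elements
  of \<open>N\<close>, which is at most the new room.
\<close>

lemma gaps_below_room_extend:
  assumes F: "gaps_below_room F" and q: "0 < q" "q < 1"
  obtains F' where "gaps_below_room F'" "F \<subseteq> F'" "\<exists>B\<subseteq>F'. \<Sum>B = q"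
proof -
  have fin: "finite F" and pos: "\<And>x. x \<in> F \<Longrightarrow> 0 < x"
    using F by (auto simp: gaps_below_room_def Qpos_def)
  obtain B where B: "B \<subseteq> F" "\<Sum>B \<le> q" "q - \<Sum>B < 1 - \<Sum>F"
    using F q unfolding gaps_below_room_def by (meson less_imp_le)
  define d where "d = q - \<Sum>B"
  show thesis
  proof (cases "d = 0")
    case True
    then show ?thesis using that[of F] F B d_def by auto
  next
    case False
    then have d: "0 < d" "d < 1 - \<Sum>F" using B d_def by auto
    \<comment> \<open>New elements below \<open>1 - \<Sum>F - d\<close> keep the gaps small; those below \<open>Min F\<close> are really new.\<close>
    define e where "e = Min (insert (1 - \<Sum>F - d) F)"
    have e: "0 < e" "e \<le> 1 - \<Sum>F - d" "\<And>x. x \<in> F \<Longrightarrow> e \<le> x"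
      unfolding e_def using fin pos d by auto
    obtain N where N: "finite N" "\<Sum>N = d" "\<And>x. x \<in> N \<Longrightarrow> 0 < x" "\<And>x. x \<in> N \<Longrightarrow> x < e"
      using sum_of_small_distinct[OF d(1) e(1)] by metis
    have disj: "F \<inter> N = {}" using N(4) e(3) by fastforce
    have sum_Un: "\<Sum>(C \<union> M) = \<Sum>C + \<Sum>M" if "C \<subseteq> F" "M \<subseteq> N" for C M
      using that disj fin N(1) by (intro sum.union_disjoint) (auto intro: finite_subset)
    have sum_FN: "\<Sum>(F \<union> N) = \<Sum>F + d" using sum_Un N(2) by simp
    have approx: "\<exists>C\<subseteq>F \<union> N. \<Sum>C \<le> p \<and> p - \<Sum>C < 1 - \<Sum>(F \<union> N)" if p: "0 \<le> p" "p < 1" for p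
    proof -
      obtain C where C: "C \<subseteq> F" "\<Sum>C \<le> p" "p - \<Sum>C < 1 - \<Sum>F"
        using F p unfolding gaps_below_room_def by meson
      obtain M where M: "M \<subseteq> N" "\<Sum>M \<le> p - \<Sum>C" "p - \<Sum>C - \<Sum>M < 1 - \<Sum>F - d"
      proof (cases "p - \<Sum>C < d")
        case True
        then obtain M where "M \<subseteq> N" "\<Sum>M \<le> p - \<Sum>C" "p - \<Sum>C < \<Sum>M + e"
          using subset_sum_just_below[of N e "p - \<Sum>C"] N C by auto
        then show ?thesis using that[of M] e(2) by simp
      next
        case False
        then show ?thesis using that[of N] C N(2) by simp
      qed
      have "\<Sum>(C \<union> M) \<le> p \<and> p - \<Sum>(C \<union> M) < 1 - \<Sum>(F \<union> N)"
        using M sum_Un[OF C(1) M(1)] sum_FN by simp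
      then show ?thesis using C(1) M(1) by (metis Un_mono)
    qed
    have "gaps_below_room (F \<union> N)"
      unfolding gaps_below_room_def
      using fin N pos d approx by (auto simp: sum_FN Qpos_def)
    moreover have "\<Sum>(B \<union> N) = q" using sum_Un[OF B(1)] N(2) d_def by simp
    then have "\<exists>C\<subseteq>F \<union> N. \<Sum>C = q" using B(1) by (metis Un_mono order_refl)
    ultimately show ?thesis using that[of "F \<union> N"] by simp
  qed
qed

section \<open>Representing the rationals below one\<close>

lemma representing_set_with_sums_below_one:
  obtains Y :: "rat set" where "Y \<subseteq> Qpos"
    "\<And>S. S \<subseteq> Y \<Longrightarrow> finite S \<Longrightarrow> \<Sum>S < 1"
    "\<And>q. 0 < q \<Longrightarrow> q < 1 \<Longrightarrow> \<exists>S\<subseteq>Y. finite S \<and> \<Sum>S = q"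
proof -
  let ?R = "\<lambda>n (F::rat set) F'. F \<subseteq> F' \<and>
    (0 < (from_nat n :: rat) \<and> from_nat n < (1::rat) \<longrightarrow> (\<exists>B\<subseteq>F'. \<Sum>B = from_nat n))"
  have "\<exists>f. \<forall>n. gaps_below_room (f n) \<and> ?R n (f n) (f (Suc n))"
  proof (rule dependent_nat_choice)
    show "\<exists>F. gaps_below_room F" using gaps_below_room_empty by blast
  next
    fix F n
    assume F: "gaps_below_room F"
    show "\<exists>F'. gaps_below_room F' \<and> ?R n F F'"
    proof (cases "0 < (from_nat n :: rat) \<and> from_nat n < (1::rat)")
      case True
      obtain F' where "gaps_below_room F'" "F \<subseteq> F'" "\<exists>B\<subseteq>F'. \<Sum>B = from_nat n"
        by (rule gaps_below_room_extend[OF F conjunct1[OF True] conjunct2[OF True]])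
      then show ?thesis by blast
    next
      case False
      then show ?thesis using F by blast
    qed
  qed
  then obtain f where f: "\<And>n. gaps_below_room (f n)" and R: "\<And>n. ?R n (f n) (f (Suc n))"
    by blast
  have mono: "incseq f" using R by (simp add: incseq_SucI)
  have below: "\<Sum>S < 1" if "S \<subseteq> (\<Union>n. f n)" "finite S" for S
  proof -
    have "\<exists>n. S \<subseteq> f n"
      using that(2,1)
    proof (induction S rule: finite_induct)
      case (insert a S)
      then obtain m k where "S \<subseteq> f m" "a \<in> f k" by auto
      then have "insert a S \<subseteq> f (max m k)"
        using monoD[OF mono, of m "max m k"] monoD[OF mono, of k "max m k"] by auto
      then show ?case by blast
    qed simp
    then obtain n where n: "S \<subseteq> f n" by blast
    have "\<Sum>S \<le> \<Sum>(f n)"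
      using n f[of n] by (intro sum_mono2) (auto simp: gaps_below_room_def Qpos_def)
    then show ?thesis using f[of n] by (simp add: gaps_below_room_def)
  qed
  have repr: "\<exists>S\<subseteq>(\<Union>n. f n). finite S \<and> \<Sum>S = q" if q: "0 < q" "q < 1" for q
  proof -
    obtain B where B: "B \<subseteq> f (Suc (to_nat q))" "\<Sum>B = q"
      using R[of "to_nat q"] q by auto
    moreover have "finite B"
      using B(1) f[of "Suc (to_nat q)"] by (auto simp: gaps_below_room_def intro: finite_subset)
    ultimately show ?thesis by blast
  qed
  have "(\<Union>n. f n) \<subseteq> Qpos" using f by (auto simp: gaps_below_room_def)
  then show thesis using that below repr by blast
qed

theorem theorem6p5:
  shows "\<exists>X::rat set. X \<subseteq> Qpos
    \<and> (\<lambda>S. \<Sum>x\<in>S. x) ` fin_nonempty_subsets X = Qpos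
    \<and> 1 \<in> X
    \<and> (\<forall>S \<in> fin_nonempty_subsets X. (\<Sum>x\<in>S. x) = 1 \<longleftrightarrow> S = {1})"
proof -
  obtain Y :: "rat set" where Y: "Y \<subseteq> Qpos"
    and below: "\<And>S. S \<subseteq> Y \<Longrightarrow> finite S \<Longrightarrow> \<Sum>S < 1"
    and repr: "\<And>q. 0 < q \<Longrightarrow> q < 1 \<Longrightarrow> \<exists>S\<subseteq>Y. finite S \<and> \<Sum>S = q"
    using representing_set_with_sums_below_one by metis
  define X where "X = Y \<union> {1..}"
  have pos: "X \<subseteq> Qpos" using Y by (auto simp: X_def Qpos_def)
  have subset_sum_pos: "0 < \<Sum>S" if "S \<in> fin_nonempty_subsets X" for S
    using that pos by (intro sum_pos) (auto simp: fin_nonempty_subsets_def Qpos_def)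
  have hit: "\<exists>S\<in>fin_nonempty_subsets X. \<Sum>S = q" if q: "0 < q" for q
  proof (cases "q < 1")
    case True
    then obtain S where "S \<subseteq> Y" "finite S" "\<Sum>S = q" using repr[OF q True] by blast
    moreover from this have "S \<noteq> {}" using q by auto
    ultimately show ?thesis by (auto simp: X_def fin_nonempty_subsets_def)
  next
    case False
    then show ?thesis
      by (intro bexI[of _ "{q}"]) (simp_all add: X_def fin_nonempty_subsets_def)
  qed
  have only: "S = {1}" if S: "S \<in> fin_nonempty_subsets X" "\<Sum>S = 1" for S
  proof -
    have fin: "finite S" and SX: "S \<subseteq> X" using S by (auto simp: fin_nonempty_subsets_def)
    obtain x where x: "x \<in> S" "1 \<le> x"
    proof -
      have "\<not> S \<subseteq> Y" using below[of S] S(2) fin by auto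
      then show ?thesis using SX that by (auto simp: X_def)
    qed
    have split: "x + \<Sum>(S - {x}) = 1" using sum.remove[OF fin x(1), of "\<lambda>x. x"] S(2) by simp
    have "S - {x} = {}"
    proof (rule ccontr)
      assume "S - {x} \<noteq> {}"
      then have "0 < \<Sum>(S - {x})"
        using fin SX by (intro subset_sum_pos) (auto simp: fin_nonempty_subsets_def)
      then show False using split x(2) by simp
    qed
    then have "S = {x}" using x(1) by blast
    then show ?thesis using split by simp
  qed
  have "(\<lambda>S. \<Sum>x\<in>S. x) ` fin_nonempty_subsets X = Qpos"
  proof (intro equalityI subsetI)
    fix q
    assume "q \<in> Qpos"
    then obtain S where "S \<in> fin_nonempty_subsets X" "\<Sum>S = q"
      using hit[of q] unfolding Qpos_def by blast
    then show "q \<in> (\<lambda>S. \<Sum>x\<in>S. x) ` fin_nonempty_subsets X" by blast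
  qed (use subset_sum_pos in \<open>auto simp: Qpos_def\<close>)
  moreover have "1 \<in> X" by (simp add: X_def)
  moreover have "\<Sum>S = 1 \<longleftrightarrow> S = {1}" if "S \<in> fin_nonempty_subsets X" for S
    using only[OF that] by (metis sum.empty sum.insert_if finite.emptyI empty_iff add_0_right)
  ultimately show ?thesis using pos by blast
qed

end
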